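(* For all names $P,Q$ with $\eta\,P\,\mathrm{Solid}$ and $\eta\,Q\,\mathrm{Solid}$, and all names $R,S,Z$: if $R\equiv\mathrm{InteriorG}(P)$, $S\equiv\mathrm{InteriorG}(Q)$ and $Z\equiv\mathrm{b\_prod}(P,Q)$, then $\mathrm{b\_prod}(R,S)\equiv\mathrm{InteriorG}(Z)$.
   Context: Logic is classical. Names form a type $N$; a name may designate zero, one or several objects. The relation $\eta : N\to N\to \mathrm{Prop}$ (singular inclusion) is governed by Leśniewski's Ontology: $\eta\,A\,b$ holds iff [there is $C$ with $\eta\,C\,A$] and [for all $C,D$, $\eta\,C\,A$ and $\eta\,D\,A$ imply $\eta\,C\,D$] and [for all $C$, $\eta\,C\,A$ implies $\eta\,C\,b$]; i.e. $A$ designates exactly one object, which is among those designated by $b$. $A$ is an Individual iff $\eta\,A\,A$. Notation: $P\equiv Q$ iff $\eta\,P\,Q$ and $\eta\,Q\,P$; $a\approx b$ iff $\forall P,\ \eta\,P\,a\leftrightarrow\eta\,P\,b$; $a\subseteq b$ iff $\forall P,\ \eta\,P\,a\to\eta\,P\,b$; $\eta\,P\,(a\cap b)$ iff $\eta\,P\,a$ and $\eta\,P\,b$. Names with the same extension are interchangeable. Name-forming operators are introduced by stating when $\eta\,P\,(\cdot)$ holds. Mereology: $\eta\,P\,(\mathrm{pt}(Q))$ ("$P$ is a part of $Q$") relates individuals and is reflexive on individuals, transitive, and antisymmetric up to $\equiv$; $\eta\,P\,(\mathrm{ppt}(Q))$ (proper part) means $\eta\,P\,(\mathrm{pt}(Q))$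 and not $P\equiv Q$; $\eta\,P\,(\mathrm{ext}(Q))$ means $P,Q$ are individuals with no common part. $\eta\,A\,(\mathrm{klass}(a))$ iff $A$ is an Individual, every $B$ with $\eta\,B\,a$ satisfies $\eta\,B\,(\mathrm{pt}(A))$, and for every $B$ with $\eta\,B\,(\mathrm{pt}(A))$ there exist $C,D$ with $\eta\,C\,a$, $\eta\,D\,(\mathrm{pt}(C))$, $\eta\,D\,(\mathrm{pt}(B))$. If some $C$ satisfies $\eta\,C\,a$, then there is $A$ with $\eta\,A\,(\mathrm{klass}(a))$, unique up to $\equiv$. Meet: $\eta\,R\,(\mathrm{b\_prod}(P,Q))$ iff $\eta\,P\,P$, $\eta\,Q\,Q$ and $\eta\,R\,(\mathrm{klass}(\mathrm{pt}(P)\cap\mathrm{pt}(Q)))$. Geometry: $\mathrm{balls}$ is a primitive name whose members are individuals (balls); at least one ball exists. $\eta\,P\,(\mathrm{Concent}(Q))$ means that the balls $P,Q$ are concentric in Tarski's sense: $P\equiv Q$; or $P$ is a proper part of $Q$ and any two balls $X,Y$ externally diametrical to $P$ and internally tangent to $Q$ are internally diametrical to $Q$; or the same with $P,Q$ exchanged. Here (all variables balls): $A$ is externally tangent to $B$ if $A$ is external to $B$ and of any two balls $X,Y$ having $A$ as part and external to $B$ one is part of the other; $A$ is internally tangent to $B$ if $A$ is a proper part of $B$ and of any two balls $X,Y$ having $A$ as part and being parts of $B$ one is part of the other; $A,B$ are externally diametrical to $C$ if both are externally tangent to $C$ and whenever $X,Y$ are external to $C$, $A$ is part of $X$ and $B$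 is part of $Y$, then $X$ is external to $Y$; $A,B$ are internally diametrical to $C$ if both are internally tangent to $C$ and whenever $X,Y$ are external to $C$, $A$ is externally tangent to $X$ and $B$ to $Y$, then $X$ is external to $Y$. $\eta\,P\,(\mathrm{Point}(Q))$ iff $\eta\,P\,\mathrm{balls}$, $\eta\,Q\,\mathrm{balls}$ and $\eta\,P\,(\mathrm{Concent}(Q))$. Standing assumptions: concentricity is an equivalence relation on balls, and concentric balls $P,Q$ satisfy $\mathrm{Point}(P)\approx\mathrm{Point}(Q)$. $\eta\,P\,\mathrm{Solid}$ iff $P$ is an Individual and there is $b\subseteq\mathrm{balls}$ with $\eta\,P\,(\mathrm{klass}(b))$; parts of solids are assumed to be solids (if $\eta\,Q\,\mathrm{Solid}$ and $\eta\,P\,(\mathrm{pt}(Q))$ then $\eta\,P\,\mathrm{Solid}$). $\eta\,P\,(\mathrm{sat\_InteriorPoint}(Q))$ iff $\eta\,Q\,\mathrm{Solid}$ and there is $P'$ with $\eta\,P\,(\mathrm{Point}(P'))$, $\eta\,P'\,(\mathrm{pt}(Q))$, and ($\eta\,P'\,(\mathrm{pt}(P))\to P\equiv P'$). $\eta\,P\,(\mathrm{InteriorG}(Q))$ iff $\eta\,P\,(\mathrm{klass}(\mathrm{sat\_InteriorPoint}(Q)))$. *)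

theory Defs
  imports Main
begin

section \<open>Names and singular inclusion\<close>

definition Individual :: "('n \<Rightarrow> 'n \<Rightarrow> bool) \<Rightarrow> 'n \<Rightarrow> bool" where
  "Individual \<eta> A \<longleftrightarrow> \<eta> A A"

definition identical :: "('n \<Rightarrow> 'n \<Rightarrow> bool) \<Rightarrow> 'n \<Rightarrow> 'n \<Rightarrow> bool" where
  "identical \<eta> P Q \<longleftrightarrow> \<eta> P Q \<and> \<eta> Q P"

definition coextensive :: "('n \<Rightarrow> 'n \<Rightarrow> bool) \<Rightarrow> 'n \<Rightarrow> 'n \<Rightarrow> bool" where
  "coextensive \<eta> a b \<longleftrightarrow> (\<forall>P. \<eta> P a \<longleftrightarrow> \<eta> P b)"

definition subname :: "('n \<Rightarrow> 'n \<Rightarrow> bool) \<Rightarrow> 'n \<Rightarrow> 'n \<Rightarrow> bool" where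
  "subname \<eta> a b \<longleftrightarrow> (\<forall>P. \<eta> P a \<longrightarrow> \<eta> P b)"

text \<open>
  A name-forming operator is a locale parameter together with the assumption that
  fixes the extension of the names it forms; by extensionality this determines the
  operator. There is no comprehension principle for arbitrary predicates of names.
\<close>

locale ontology =
  fixes \<eta> :: "'n \<Rightarrow> 'n \<Rightarrow> bool"
    and cap :: "'n \<Rightarrow> 'n \<Rightarrow> 'n"
  assumes ontology_axiom:
    "\<eta> A b \<longleftrightarrow>
       (\<exists>C. \<eta> C A) \<and>
       (\<forall>C D. \<eta> C A \<and> \<eta> D A \<longrightarrow> \<eta> C D) \<and>
       (\<forall>C. \<eta> C A \<longrightarrow> \<eta> C b)"
    and extensionality: "coextensive \<eta> a b \<Longrightarrow> a = b"
    and cap_iff: "\<eta> P (cap a b) \<longleftrightarrow> \<eta> P a \<and> \<eta> P b"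


section \<open>Mereology\<close>

locale mereology = ontology \<eta> cap
  for \<eta> :: "'n \<Rightarrow> 'n \<Rightarrow> bool"
    and cap :: "'n \<Rightarrow> 'n \<Rightarrow> 'n" +
  fixes pt ppt ext klass :: "'n \<Rightarrow> 'n"
    and b_prod :: "'n \<Rightarrow> 'n \<Rightarrow> 'n"
  assumes pt_individuals: "\<eta> P (pt Q) \<Longrightarrow> Individual \<eta> P \<and> Individual \<eta> Q"
    and pt_refl: "Individual \<eta> P \<Longrightarrow> \<eta> P (pt P)"
    and pt_trans: "\<eta> P (pt Q) \<Longrightarrow> \<eta> Q (pt R) \<Longrightarrow> \<eta> P (pt R)"
    and pt_antisym: "\<eta> P (pt Q) \<Longrightarrow> \<eta> Q (pt P) \<Longrightarrow> identical \<eta> P Q"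
    and ppt_iff: "\<eta> P (ppt Q) \<longleftrightarrow> \<eta> P (pt Q) \<and> \<not> identical \<eta> P Q"
    and ext_iff:
      "\<eta> P (ext Q) \<longleftrightarrow>
         Individual \<eta> P \<and> Individual \<eta> Q \<and> \<not> (\<exists>R. \<eta> R (pt P) \<and> \<eta> R (pt Q))"
    and klass_iff:
      "\<eta> A (klass a) \<longleftrightarrow>
         Individual \<eta> A \<and>
         (\<forall>B. \<eta> B a \<longrightarrow> \<eta> B (pt A)) \<and>
         (\<forall>B. \<eta> B (pt A) \<longrightarrow> (\<exists>C D. \<eta> C a \<and> \<eta> D (pt C) \<and> \<eta> D (pt B)))"
    and klass_exists: "\<eta> C a \<Longrightarrow> \<exists>A. \<eta> A (klass a)"
    and klass_unique:
      "\<eta> C a \<Longrightarrow> \<eta> A (klass a) \<Longrightarrow> \<eta> B (klass a) \<Longrightarrow> identical \<eta> A B"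
    and b_prod_iff:
      "\<eta> R (b_prod P Q) \<longleftrightarrow> \<eta> P P \<and> \<eta> Q Q \<and> \<eta> R (klass (cap (pt P) (pt Q)))"


section \<open>Balls and Tarski's relations between them\<close>

locale ball_mereology = mereology \<eta> cap pt ppt ext klass b_prod
  for \<eta> :: "'n \<Rightarrow> 'n \<Rightarrow> bool"
    and cap :: "'n \<Rightarrow> 'n \<Rightarrow> 'n"
    and pt ppt ext klass :: "'n \<Rightarrow> 'n"
    and b_prod :: "'n \<Rightarrow> 'n \<Rightarrow> 'n" +
  fixes balls :: 'n
  assumes balls_individuals: "\<eta> P balls \<Longrightarrow> Individual \<eta> P"
    and balls_nonempty: "\<exists>P. \<eta> P balls"
begin

definition externally_tangent :: "'n \<Rightarrow> 'n \<Rightarrow> bool" where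
  "externally_tangent A B \<longleftrightarrow>
     \<eta> A balls \<and> \<eta> B balls \<and> \<eta> A (ext B) \<and>
     (\<forall>X Y. \<eta> X balls \<and> \<eta> Y balls \<and>
            \<eta> A (pt X) \<and> \<eta> X (ext B) \<and> \<eta> A (pt Y) \<and> \<eta> Y (ext B) \<longrightarrow>
            \<eta> X (pt Y) \<or> \<eta> Y (pt X))"

definition internally_tangent :: "'n \<Rightarrow> 'n \<Rightarrow> bool" where
  "internally_tangent A B \<longleftrightarrow>
     \<eta> A balls \<and> \<eta> B balls \<and> \<eta> A (ppt B) \<and>
     (\<forall>X Y. \<eta> X balls \<and> \<eta> Y balls \<and>
            \<eta> A (pt X) \<and> \<eta> X (pt B) \<and> \<eta> A (pt Y) \<and> \<eta> Y (pt B) \<longrightarrow>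
            \<eta> X (pt Y) \<or> \<eta> Y (pt X))"

definition externally_diametrical :: "'n \<Rightarrow> 'n \<Rightarrow> 'n \<Rightarrow> bool" where
  "externally_diametrical A B C \<longleftrightarrow>
     externally_tangent A C \<and> externally_tangent B C \<and>
     (\<forall>X Y. \<eta> X balls \<and> \<eta> Y balls \<and> \<eta> X (ext C) \<and> \<eta> Y (ext C) \<and>
            \<eta> A (pt X) \<and> \<eta> B (pt Y) \<longrightarrow> \<eta> X (ext Y))"

definition internally_diametrical :: "'n \<Rightarrow> 'n \<Rightarrow> 'n \<Rightarrow> bool" where
  "internally_diametrical A B C \<longleftrightarrow>
     internally_tangent A C \<and> internally_tangent B C \<and>
     (\<forall>X Y. \<eta> X balls \<and> \<eta> Y balls \<and> \<eta> X (ext C) \<and> \<eta> Y (ext C) \<and>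
            externally_tangent A X \<and> externally_tangent B Y \<longrightarrow> \<eta> X (ext Y))"

definition properly_concentric :: "'n \<Rightarrow> 'n \<Rightarrow> bool" where
  "properly_concentric P Q \<longleftrightarrow>
     \<eta> P (ppt Q) \<and>
     (\<forall>X Y. \<eta> X balls \<and> \<eta> Y balls \<and> externally_diametrical X Y P \<and>
            internally_tangent X Q \<and> internally_tangent Y Q \<longrightarrow>
            internally_diametrical X Y Q)"

definition concentric :: "'n \<Rightarrow> 'n \<Rightarrow> bool" where
  "concentric P Q \<longleftrightarrow>
     \<eta> P balls \<and> \<eta> Q balls \<and>
     (identical \<eta> P Q \<or> properly_concentric P Q \<or> properly_concentric Q P)"

end


section \<open>Points, solids and interiors\<close>

locale solid_geometry = ball_mereology \<eta> cap pt ppt ext klass b_prod balls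
  for \<eta> :: "'n \<Rightarrow> 'n \<Rightarrow> bool"
    and cap :: "'n \<Rightarrow> 'n \<Rightarrow> 'n"
    and pt ppt ext klass :: "'n \<Rightarrow> 'n"
    and b_prod :: "'n \<Rightarrow> 'n \<Rightarrow> 'n"
    and balls :: 'n +
  fixes Concent Point :: "'n \<Rightarrow> 'n"
    and Solid :: 'n
    and sat_InteriorPoint InteriorG :: "'n \<Rightarrow> 'n"
  assumes Concent_iff: "\<eta> P (Concent Q) \<longleftrightarrow> concentric P Q"
    and Concent_equiv: "equiv {P. \<eta> P balls} {(P, Q). \<eta> P (Concent Q)}"
    and Point_iff: "\<eta> P (Point Q) \<longleftrightarrow> \<eta> P balls \<and> \<eta> Q balls \<and> \<eta> P (Concent Q)"
    and Point_Concent: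
      "\<eta> P balls \<Longrightarrow> \<eta> Q balls \<Longrightarrow> \<eta> P (Concent Q) \<Longrightarrow> coextensive \<eta> (Point P) (Point Q)"
    and Solid_iff:
      "\<eta> P Solid \<longleftrightarrow> Individual \<eta> P \<and> (\<exists>b. subname \<eta> b balls \<and> \<eta> P (klass b))"
    and part_of_Solid: "\<eta> Q Solid \<Longrightarrow> \<eta> P (pt Q) \<Longrightarrow> \<eta> P Solid"
    and sat_InteriorPoint_iff:
      "\<eta> P (sat_InteriorPoint Q) \<longleftrightarrow>
         \<eta> Q Solid \<and>
         (\<exists>P'. \<eta> P (Point P') \<and> \<eta> P' (pt Q) \<and> (\<eta> P' (pt P) \<longrightarrow> identical \<eta> P P'))"
    and InteriorG_iff: "\<eta> P (InteriorG Q) \<longleftrightarrow> \<eta> P (klass (sat_InteriorPoint Q))"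

end

theory Submission
  imports Defs
begin

text \<open>
  The interior of a solid is the solid itself. A ball \<open>P\<close> satisfies the
  condition for being an interior point of \<open>Q\<close> through a concentric ball \<open>P'\<close>
  that is part of \<open>Q\<close>; of two concentric balls one is part of the other, and the
  clause on \<open>P'\<close> rules out that \<open>P'\<close> is the strictly smaller one. Thus \<open>P\<close> is part
  of \<open>P'\<close>, hence of \<open>Q\<close>, and the interior points of \<open>Q\<close> are simply the balls that are
  parts of \<open>Q\<close> (\<open>sat_InteriorPoint_Solid\<close>). A solid, being the class of some balls,
  is also the class of all the balls in it, so \<open>InteriorG\<close> fixes it
  (\<open>InteriorG_Solid\<close>).

  This reduces the claim to showing that the meet of two solids is a solid
  (\<open>Solid_b_prod\<close>). Every common part of them is a part of a solid, hence a solid,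
  hence contains a ball; so the balls that are common parts already have the meet
  as their class.
\<close>

lemma (in ontology) identical_imp_eq:
  assumes "identical \<eta> A B"
  shows "A = B"
proof (rule extensionality)
  show "coextensive \<eta> A B"
    using assms ontology_axiom[of A B] ontology_axiom[of B A]
    unfolding identical_def coextensive_def by blast
qed

context mereology
begin

lemma klass_member:
  assumes "\<eta> A (klass a)"
  obtains C where "\<eta> C a"
  using assms klass_iff pt_refl by blast

text \<open>
  A class is unique up to identity, so the name \<open>klass a\<close> is itself singular as soon
  as it designates anything; extensionality turns this into an equation for rewriting.
\<close>
lemma klass_eq:
  assumes "\<eta> A (klass a)"
  shows "klass a = A"
proof -
  obtain C where C: "\<eta> C a"
    using assms by (rule klass_member)
  have all: "\<eta> B A" if "\<eta> B (klass a)" for B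
    using klass_unique[OF C that assms] by (simp add: identical_def)
  have "\<eta> B D" if "\<eta> B (klass a)" "\<eta> D (klass a)" for B D
    using klass_unique[OF C that] by (simp add: identical_def)
  with all assms have "\<eta> (klass a) A"
    by (subst ontology_axiom) blast
  with assms have "identical \<eta> (klass a) A"
    by (simp add: identical_def)
  then show ?thesis
    by (rule identical_imp_eq)
qed

end

context solid_geometry
begin

lemma sat_InteriorPoint_Solid:
  assumes "\<eta> Q Solid"
  shows "\<eta> P (sat_InteriorPoint Q) \<longleftrightarrow> \<eta> P balls \<and> \<eta> P (pt Q)"
proof
  assume "\<eta> P (sat_InteriorPoint Q)"
  then obtain P' where P': "\<eta> P (Point P')" "\<eta> P' (pt Q)"
    and not_smaller: "\<eta> P' (pt P) \<longrightarrow> identical \<eta> P P'"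
    by (auto simp: sat_InteriorPoint_iff)
  have balls: "\<eta> P balls" and conc: "concentric P P'"
    using P'(1) by (auto simp: Point_iff Concent_iff)
  have "\<eta> P (pt P') \<or> P = P'"
    using conc not_smaller identical_imp_eq
    unfolding concentric_def properly_concentric_def ppt_iff by blast
  with P'(2) balls show "\<eta> P balls \<and> \<eta> P (pt Q)"
    using pt_trans by blast
next
  assume P: "\<eta> P balls \<and> \<eta> P (pt Q)"
  \<comment> \<open>Here \<open>P\<close> is its own witness.\<close>
  then have self: "identical \<eta> P P"
    using balls_individuals by (auto simp: Individual_def identical_def)
  with P have "\<eta> P (Point P)"
    by (simp add: Point_iff Concent_iff concentric_def)
  with P self assms show "\<eta> P (sat_InteriorPoint Q)"
    by (auto simp: sat_InteriorPoint_iff)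
qed

lemma InteriorG_Solid:
  assumes "\<eta> Q Solid"
  shows "InteriorG Q = Q"
proof -
  obtain b where b: "subname \<eta> b balls" "\<eta> Q (klass b)"
    using assms by (auto simp: Solid_iff)
  \<comment> \<open>Enlarging \<open>b\<close> to all balls in \<open>Q\<close> leaves its class unchanged.\<close>
  have b_sub: "\<eta> B (sat_InteriorPoint Q)" if "\<eta> B b" for B
    using that b unfolding sat_InteriorPoint_Solid[OF assms] klass_iff subname_def by blast
  have "\<eta> Q (klass (sat_InteriorPoint Q))"
    unfolding klass_iff[of Q "sat_InteriorPoint Q"]
  proof (intro conjI allI impI)
    show "Individual \<eta> Q"
      using b(2) by (simp add: klass_iff)
    show "\<eta> B (pt Q)" if "\<eta> B (sat_InteriorPoint Q)" for B
      using that by (simp add: sat_InteriorPoint_Solid[OF assms])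
    show "\<exists>C D. \<eta> C (sat_InteriorPoint Q) \<and> \<eta> D (pt C) \<and> \<eta> D (pt B)"
      if "\<eta> B (pt Q)" for B
      using that b(2) b_sub unfolding klass_iff by blast
  qed
  then have "\<eta> Q (InteriorG Q)"
    by (simp add: InteriorG_iff)
  moreover have "InteriorG Q = klass (sat_InteriorPoint Q)"
    by (rule extensionality) (simp add: coextensive_def InteriorG_iff)
  ultimately show ?thesis
    by (metis klass_eq)
qed

lemma Solid_contains_ball:
  assumes "\<eta> Q Solid"
  obtains B where "\<eta> B balls" "\<eta> B (pt Q)"
proof -
  obtain b where b: "subname \<eta> b balls" "\<eta> Q (klass b)"
    using assms by (auto simp: Solid_iff)
  obtain B where "\<eta> B b"
    using b(2) by (rule klass_member)
  with b show thesis
    by (auto simp: subname_def klass_iff intro: that)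
qed

text \<open>
  It would be natural to show that the meet is part of \<open>P\<close>, hence a solid. But the
  usual derivation of such an inclusion forms the class of the parts of \<open>P\<close> together
  with the meet, and there is no name-forming operator for unions. Instead the balls
  among the common parts are shown to have the meet as their class: each common part
  is part of \<open>P\<close>, so it is a solid and contains such a ball.
\<close>
lemma Solid_b_prod:
  assumes "\<eta> P Solid" and "\<eta> Z (b_prod P Q)"
  shows "\<eta> Z Solid"
proof -
  let ?c = "cap (pt P) (pt Q)"
  let ?b = "cap balls ?c"
  have Z: "\<eta> Z (klass ?c)"
    using assms(2) by (simp add: b_prod_iff)
  have ind: "Individual \<eta> Z"
    using Z by (simp add: klass_iff)
  have "\<eta> Z (klass ?b)"
    unfolding klass_iff[of Z ?b]
  proof (intro conjI allI impI)
    show "Individual \<eta> Z"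
      by (rule ind)
    show "\<eta> B (pt Z)" if "\<eta> B ?b" for B
      using that Z by (simp add: klass_iff cap_iff)
    fix B
    assume "\<eta> B (pt Z)"
    then obtain C D where C: "\<eta> C ?c" and D: "\<eta> D (pt C)" "\<eta> D (pt B)"
      using Z unfolding klass_iff by blast
    have D_PQ: "\<eta> D (pt P)" "\<eta> D (pt Q)"
      using C D(1) pt_trans by (auto simp: cap_iff)
    obtain E where E: "\<eta> E balls" "\<eta> E (pt D)"
      using part_of_Solid[OF assms(1) D_PQ(1)] by (rule Solid_contains_ball)
    have "\<eta> E ?b"
      using E D_PQ pt_trans by (auto simp: cap_iff)
    moreover have "\<eta> E (pt E)"
      using E(1) by (intro pt_refl balls_individuals)
    moreover have "\<eta> E (pt B)"
      using E(2) D(2) by (rule pt_trans)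
    ultimately show "\<exists>C D. \<eta> C ?b \<and> \<eta> D (pt C) \<and> \<eta> D (pt B)"
      by blast
  qed
  moreover have "subname \<eta> ?b balls"
    by (simp add: subname_def cap_iff)
  ultimately show ?thesis
    using ind Solid_iff by blast
qed

end

theorem theorem15:
  fixes \<eta> :: "'n \<Rightarrow> 'n \<Rightarrow> bool"
    and cap :: "'n \<Rightarrow> 'n \<Rightarrow> 'n"
    and pt ppt ext klass :: "'n \<Rightarrow> 'n"
    and b_prod :: "'n \<Rightarrow> 'n \<Rightarrow> 'n"
    and balls :: 'n
    and Concent Point :: "'n \<Rightarrow> 'n"
    and Solid :: 'n
    and sat_InteriorPoint InteriorG :: "'n \<Rightarrow> 'n"
    and P Q R S Z :: 'n
  assumes "solid_geometry \<eta> cap pt ppt ext klass b_prod balls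
             Concent Point Solid sat_InteriorPoint InteriorG"
    and "\<eta> P Solid" and "\<eta> Q Solid"
    and "identical \<eta> R (InteriorG P)"
    and "identical \<eta> S (InteriorG Q)"
    and "identical \<eta> Z (b_prod P Q)"
  shows "identical \<eta> (b_prod R S) (InteriorG Z)"
proof -
  interpret solid_geometry \<eta> cap pt ppt ext klass b_prod balls
    Concent Point Solid sat_InteriorPoint InteriorG
    by (rule assms(1))
  have "R = P" "S = Q"
    using identical_imp_eq[OF assms(4)] identical_imp_eq[OF assms(5)]
    by (simp_all add: InteriorG_Solid assms(2,3))
  then have prod: "b_prod R S = Z"
    using identical_imp_eq[OF assms(6)] by simp
  have "\<eta> Z Solid"
    using assms(2,6) Solid_b_prod by (auto simp: identical_def)
  then have "InteriorG Z = Z" and "identical \<eta> Z Z"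
    by (auto simp: InteriorG_Solid Solid_iff Individual_def identical_def)
  with prod show ?thesis
    by simp
qed

end
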